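(* Let $\mathbf{D}=(D;\wedge,\vee,\neg,0,1,\top)$ be an RFf-algebra, with $\bot:=\neg\top$, $\Diamond x:=x\wedge\top$ and $\Box x:=x\wedge\bot$. Then the map $\iota\colon\mathbf{D}\to\Diamond(\mathbf{D})\times\Box(\mathbf{D})$, $a\mapsto(\Diamond a,\Box\neg a)$, witnesses an isomorphism between $\mathbf{D}$ and an RFf-twist-algebra over $\Diamond(\mathbf{D})$ and $\Box(\mathbf{D})$.
   Context: A De Morgan algebra is a bounded distributive lattice with a unary operation $\neg$ satisfying $\neg\neg a=a$ and $\neg(a\wedge b)=\neg a\vee\neg b$. An RFf-algebra is an algebra $(D;\wedge,\vee,\neg,0,1,\top)$ such that $(D;\wedge,\vee,\neg,0,1)$ is a bounded De Morgan lattice (i.e. a De Morgan algebra) and: (RFf1) if $\top=1$ then $x=y$ for all $x,y\in D$; (RFf2) $\top\wedge\neg\top=0$; (RFf3) $a\wedge\top=b\wedge\top$ and $a\vee\top=b\vee\top$ imply $a=b$. Restricting the lattice operations of $\mathbf{D}$, set $\Diamond(\mathbf{D}):=(\Diamond[D];\wedge,\vee,\neg_\Diamond,0,\top)$ and $\Box(\mathbf{D}):=(\Box[D];\wedge,\vee,\neg_\Box,0,\bot)$, where $\neg_\Diamond\Diamond a:=\Diamond\neg a$ and $\neg_\Box\Box a:=\Box\neg a$; both are De Morgan algebras (with least element $0$ and greatest elements $\top$ and $\bot$ respectively). For De Morgan algebras $\mathbf{D}_1,\mathbf{D}_2$, the full RFf-twist-algebra $\mathbf{D}_1\bowtie\mathbf{D}_2$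 has universe $D_1\times D_2$ and operations $(x_1,x_2)\wedge(y_1,y_2):=(x_1\wedge y_1,x_2\vee y_2)$, $\neg(x_1,x_2):=(\neg x_1,\neg x_2)$, $\bot:=(0,0)$, with $\top:=\neg\bot$ and $x\vee y:=\neg(\neg x\wedge\neg y)$; its lattice bounds are $(0,1)$ (bottom) and $(1,0)$ (top). An RFf-twist-algebra over $\mathbf{D}_1$ and $\mathbf{D}_2$ is any subalgebra $\mathbf{C}\leqslant\mathbf{D}_1\bowtie\mathbf{D}_2$ such that $\pi_1[C]=D_1$, where $\pi_1$ is the first projection. *)

theory Defs
  imports Main
begin

record 'a dm_algebra =
  carrier :: "'a set"
  meet :: "'a \<Rightarrow> 'a \<Rightarrow> 'a" (infixl "\<sqinter>\<index>" 70)
  join :: "'a \<Rightarrow> 'a \<Rightarrow> 'a" (infixl "\<squnion>\<index>" 65)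
  neg :: "'a \<Rightarrow> 'a" ("\<sim>\<index> _" [81] 80)
  zero :: "'a" ("\<zero>\<index>")
  one :: "'a" ("\<one>\<index>")

record 'a rff_algebra = "'a dm_algebra" +
  rtop :: "'a" ("\<top>\<index>")

locale de_morgan_algebra =
  fixes D :: "('a, 'm) dm_algebra_scheme" (structure)
  assumes meet_closed: "x \<in> carrier D \<Longrightarrow> y \<in> carrier D \<Longrightarrow> x \<sqinter> y \<in> carrier D"
    and join_closed: "x \<in> carrier D \<Longrightarrow> y \<in> carrier D \<Longrightarrow> x \<squnion> y \<in> carrier D"
    and neg_closed: "x \<in> carrier D \<Longrightarrow> \<sim> x \<in> carrier D"
    and zero_closed: "\<zero> \<in> carrier D"
    and one_closed: "\<one> \<in> carrier D"
    and meet_assoc: "x \<in> carrier D \<Longrightarrow> y \<in> carrier D \<Longrightarrow> z \<in> carrier D \<Longrightarrow>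
      (x \<sqinter> y) \<sqinter> z = x \<sqinter> (y \<sqinter> z)"
    and join_assoc: "x \<in> carrier D \<Longrightarrow> y \<in> carrier D \<Longrightarrow> z \<in> carrier D \<Longrightarrow>
      (x \<squnion> y) \<squnion> z = x \<squnion> (y \<squnion> z)"
    and meet_commute: "x \<in> carrier D \<Longrightarrow> y \<in> carrier D \<Longrightarrow> x \<sqinter> y = y \<sqinter> x"
    and join_commute: "x \<in> carrier D \<Longrightarrow> y \<in> carrier D \<Longrightarrow> x \<squnion> y = y \<squnion> x"
    and meet_join_absorb: "x \<in> carrier D \<Longrightarrow> y \<in> carrier D \<Longrightarrow> x \<sqinter> (x \<squnion> y) = x"
    and join_meet_absorb: "x \<in> carrier D \<Longrightarrow> y \<in> carrier D \<Longrightarrow> x \<squnion> (x \<sqinter> y) = x"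
    and meet_join_distrib: "x \<in> carrier D \<Longrightarrow> y \<in> carrier D \<Longrightarrow> z \<in> carrier D \<Longrightarrow>
      x \<sqinter> (y \<squnion> z) = (x \<sqinter> y) \<squnion> (x \<sqinter> z)"
    and zero_join: "x \<in> carrier D \<Longrightarrow> \<zero> \<squnion> x = x"
    and one_meet: "x \<in> carrier D \<Longrightarrow> \<one> \<sqinter> x = x"
    and neg_neg: "x \<in> carrier D \<Longrightarrow> \<sim> (\<sim> x) = x"
    and neg_meet: "x \<in> carrier D \<Longrightarrow> y \<in> carrier D \<Longrightarrow> \<sim> (x \<sqinter> y) = \<sim> x \<squnion> \<sim> y"

locale rff_algebra = de_morgan_algebra D
  for D :: "('a, 'm) rff_algebra_scheme" (structure) +
  assumes top_closed: "\<top> \<in> carrier D"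
    and RFf1: "\<top> = \<one> \<Longrightarrow> x \<in> carrier D \<Longrightarrow> y \<in> carrier D \<Longrightarrow> x = y"
    and RFf2: "\<top> \<sqinter> \<sim> \<top> = \<zero>"
    and RFf3: "a \<in> carrier D \<Longrightarrow> b \<in> carrier D \<Longrightarrow>
      a \<sqinter> \<top> = b \<sqinter> \<top> \<Longrightarrow> a \<squnion> \<top> = b \<squnion> \<top> \<Longrightarrow> a = b"

definition rbot :: "('a, 'm) rff_algebra_scheme \<Rightarrow> 'a" ("\<bottom>\<index>") where
  "\<bottom>\<^bsub>D\<^esub> = \<sim>\<^bsub>D\<^esub> \<top>\<^bsub>D\<^esub>"

definition dia :: "('a, 'm) rff_algebra_scheme \<Rightarrow> 'a \<Rightarrow> 'a" where
  "dia D x = x \<sqinter>\<^bsub>D\<^esub> \<top>\<^bsub>D\<^esub>"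

definition box :: "('a, 'm) rff_algebra_scheme \<Rightarrow> 'a \<Rightarrow> 'a" where
  "box D x = x \<sqinter>\<^bsub>D\<^esub> \<bottom>\<^bsub>D\<^esub>"

text \<open>The negations below are prescribed on representatives, sending \<open>dia D a\<close> to
  \<open>dia D (\<sim>\<^bsub>D\<^esub> a)\<close> and \<open>box D a\<close> to \<open>box D (\<sim>\<^bsub>D\<^esub> a)\<close>. The description operator picks
  out this value, which is meaningful only if it does not depend on the representative.\<close>

definition Dia :: "('a, 'm) rff_algebra_scheme \<Rightarrow> 'a dm_algebra" where
  "Dia D = \<lparr> carrier = dia D ` carrier D,
     meet = meet D,
     join = join D,
     neg = (\<lambda>y. THE z. \<exists>a\<in>carrier D. y = dia D a \<and> z = dia D (\<sim>\<^bsub>D\<^esub> a)),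
     zero = \<zero>\<^bsub>D\<^esub>,
     one = \<top>\<^bsub>D\<^esub> \<rparr>"

definition Box :: "('a, 'm) rff_algebra_scheme \<Rightarrow> 'a dm_algebra" where
  "Box D = \<lparr> carrier = box D ` carrier D,
     meet = meet D,
     join = join D,
     neg = (\<lambda>y. THE z. \<exists>a\<in>carrier D. y = box D a \<and> z = box D (\<sim>\<^bsub>D\<^esub> a)),
     zero = \<zero>\<^bsub>D\<^esub>,
     one = \<bottom>\<^bsub>D\<^esub> \<rparr>"

definition twist_meet :: "('a, 'm) dm_algebra_scheme \<Rightarrow> ('b, 'n) dm_algebra_scheme
    \<Rightarrow> 'a \<times> 'b \<Rightarrow> 'a \<times> 'b \<Rightarrow> 'a \<times> 'b" where
  "twist_meet D1 D2 x y = (fst x \<sqinter>\<^bsub>D1\<^esub> fst y, snd x \<squnion>\<^bsub>D2\<^esub> snd y)"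

definition twist_neg :: "('a, 'm) dm_algebra_scheme \<Rightarrow> ('b, 'n) dm_algebra_scheme
    \<Rightarrow> 'a \<times> 'b \<Rightarrow> 'a \<times> 'b" where
  "twist_neg D1 D2 x = (\<sim>\<^bsub>D1\<^esub> (fst x), \<sim>\<^bsub>D2\<^esub> (snd x))"

text \<open>The bounds \<open>zero\<close> and \<open>one\<close> are listed so that the twist algebra has the signature of an
  RFf-algebra; they are term-definable from meet, negation and \<open>(\<zero>, \<zero>)\<close>, so they do not affect
  which subsets are subuniverses. The constant \<open>(\<zero>, \<zero>)\<close> itself is \<open>rbot\<close> of the twist algebra.\<close>

definition twist :: "('a, 'm) dm_algebra_scheme \<Rightarrow> ('b, 'n) dm_algebra_scheme
    \<Rightarrow> ('a \<times> 'b) rff_algebra" (infix "\<bowtie>" 60) where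
  "D1 \<bowtie> D2 = \<lparr> carrier = carrier D1 \<times> carrier D2,
     meet = twist_meet D1 D2,
     join = (\<lambda>x y. twist_neg D1 D2
               (twist_meet D1 D2 (twist_neg D1 D2 x) (twist_neg D1 D2 y))),
     neg = twist_neg D1 D2,
     zero = (\<zero>\<^bsub>D1\<^esub>, \<one>\<^bsub>D2\<^esub>),
     one = (\<one>\<^bsub>D1\<^esub>, \<zero>\<^bsub>D2\<^esub>),
     rtop = twist_neg D1 D2 (\<zero>\<^bsub>D1\<^esub>, \<zero>\<^bsub>D2\<^esub>) \<rparr>"

definition rff_subalgebra :: "'a rff_algebra \<Rightarrow> 'a rff_algebra \<Rightarrow> bool" where
  "rff_subalgebra C A \<longleftrightarrow>
     carrier C \<subseteq> carrier A \<and>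
     (\<forall>x\<in>carrier C. \<forall>y\<in>carrier C.
        x \<sqinter>\<^bsub>A\<^esub> y \<in> carrier C \<and> x \<sqinter>\<^bsub>C\<^esub> y = x \<sqinter>\<^bsub>A\<^esub> y \<and>
        x \<squnion>\<^bsub>A\<^esub> y \<in> carrier C \<and> x \<squnion>\<^bsub>C\<^esub> y = x \<squnion>\<^bsub>A\<^esub> y) \<and>
     (\<forall>x\<in>carrier C. \<sim>\<^bsub>A\<^esub> x \<in> carrier C \<and> \<sim>\<^bsub>C\<^esub> x = \<sim>\<^bsub>A\<^esub> x) \<and>
     \<zero>\<^bsub>A\<^esub> \<in> carrier C \<and> \<zero>\<^bsub>C\<^esub> = \<zero>\<^bsub>A\<^esub> \<and>
     \<one>\<^bsub>A\<^esub> \<in> carrier C \<and> \<one>\<^bsub>C\<^esub> = \<one>\<^bsub>A\<^esub> \<and>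
     \<top>\<^bsub>A\<^esub> \<in> carrier C \<and> \<top>\<^bsub>C\<^esub> = \<top>\<^bsub>A\<^esub>"

definition rff_twist_algebra :: "('a, 'm) dm_algebra_scheme \<Rightarrow> ('b, 'n) dm_algebra_scheme
    \<Rightarrow> ('a \<times> 'b) rff_algebra \<Rightarrow> bool" where
  "rff_twist_algebra D1 D2 C \<longleftrightarrow>
     de_morgan_algebra D1 \<and> de_morgan_algebra D2 \<and>
     rff_subalgebra C (D1 \<bowtie> D2) \<and> fst ` carrier C = carrier D1"

definition rff_isomorphism :: "('a \<Rightarrow> 'b) \<Rightarrow> 'a rff_algebra \<Rightarrow> 'b rff_algebra \<Rightarrow> bool" where
  "rff_isomorphism f A B \<longleftrightarrow>
     bij_betw f (carrier A) (carrier B) \<and>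
     (\<forall>x\<in>carrier A. \<forall>y\<in>carrier A.
        f (x \<sqinter>\<^bsub>A\<^esub> y) = f x \<sqinter>\<^bsub>B\<^esub> f y \<and> f (x \<squnion>\<^bsub>A\<^esub> y) = f x \<squnion>\<^bsub>B\<^esub> f y) \<and>
     (\<forall>x\<in>carrier A. f (\<sim>\<^bsub>A\<^esub> x) = \<sim>\<^bsub>B\<^esub> (f x)) \<and>
     f \<zero>\<^bsub>A\<^esub> = \<zero>\<^bsub>B\<^esub> \<and> f \<one>\<^bsub>A\<^esub> = \<one>\<^bsub>B\<^esub> \<and> f \<top>\<^bsub>A\<^esub> = \<top>\<^bsub>B\<^esub>"

end

theory Submission
  imports Defs
begin

text \<open>
  Call an element \<open>t\<close> of a De Morgan algebra consistent if \<open>t \<sqinter> \<sim> t = \<zero>\<close>. Then meeting with \<open>t\<close>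
  forgets joins with \<open>\<sim> t\<close>: \<open>(x \<squnion> \<sim> t) \<sqinter> t = x \<sqinter> t\<close>. Hence \<open>a \<sqinter> t = b \<sqinter> t\<close> forces
  \<open>\<sim> a \<sqinter> t = \<sim> b \<sqinter> t\<close> (negate both sides and meet with \<open>t\<close>), so that the negation inherited by the
  ideal below \<open>t\<close> through \<open>a \<mapsto> a \<sqinter> t\<close> is well defined, and by the same identity it is an involution.
  This makes the ideal a De Morgan algebra and \<open>a \<mapsto> a \<sqinter> t\<close> a homomorphism onto it.
  By RFf2 both \<open>\<top>\<close> and \<open>\<bottom>\<close> are consistent, and the algebras \<open>Dia D\<close> and \<open>Box D\<close> are the two
  instances.

  The first coordinate of the map \<open>\<iota>\<close> (\<open>twist_map\<close> below) is the first of these homomorphisms; the second coordinate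
  follows the other one with a negation, which turns meets into joins and so matches the order
  reversal in the second factor of the twist product. Thus \<open>\<iota>\<close> preserves the operations and its
  image is a subalgebra; the first projection of the image is everything by the definition of \<open>Dia D\<close>.
  Finally \<open>\<box>\<sim> a\<close> carries the same information as its negation \<open>a \<squnion> \<top>\<close>, so the
  injectivity of \<open>\<iota>\<close> is exactly RFf3.
\<close>

context de_morgan_algebra
begin

lemmas closed = meet_closed join_closed neg_closed zero_closed one_closed

lemma neg_join:
  assumes "x \<in> carrier D" "y \<in> carrier D"
  shows "\<sim> (x \<squnion> y) = \<sim> x \<sqinter> \<sim> y"
  by (metis assms neg_meet neg_neg meet_closed neg_closed)

lemma zero_meet:
  assumes "x \<in> carrier D"
  shows "\<zero> \<sqinter> x = \<zero>"
  by (metis assms meet_join_absorb zero_closed zero_join)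

lemma join_zero:
  assumes "x \<in> carrier D"
  shows "x \<squnion> \<zero> = x"
  by (metis assms join_commute zero_closed zero_join)

lemma neg_one: "\<sim> \<one> = \<zero>"
  by (metis join_zero neg_closed neg_join neg_neg one_closed one_meet zero_closed)

lemma neg_zero: "\<sim> \<zero> = \<one>"
  by (metis neg_one neg_neg one_closed)

lemma meet_idem:
  assumes "x \<in> carrier D"
  shows "x \<sqinter> x = x"
  by (metis assms join_zero meet_join_absorb zero_closed)

lemma join_meet_distrib_right:
  assumes "x \<in> carrier D" "y \<in> carrier D" "z \<in> carrier D"
  shows "(x \<squnion> y) \<sqinter> z = (x \<sqinter> z) \<squnion> (y \<sqinter> z)"
  by (metis assms join_closed meet_commute meet_join_distrib)

lemma meet_meet_distrib_right:
  assumes "x \<in> carrier D" "y \<in> carrier D" "z \<in> carrier D"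
  shows "(x \<sqinter> y) \<sqinter> z = (x \<sqinter> z) \<sqinter> (y \<sqinter> z)"
  by (metis assms meet_assoc meet_closed meet_commute meet_idem)

lemma meet_right_idem:
  assumes "x \<in> carrier D" "t \<in> carrier D"
  shows "(x \<sqinter> t) \<sqinter> t = x \<sqinter> t"
  by (simp add: assms meet_assoc meet_idem)

text \<open>By \<open>neg_meet\<close> the left-hand side splits into \<open>\<sim> x \<sqinter> t\<close> and \<open>\<sim> t \<sqinter> t\<close>, and the latter vanishes.
  Both well-definedness and involutivity of the negation below \<open>t\<close> come from this identity.\<close>

lemma neg_meet_meet_consistent:
  assumes "x \<in> carrier D" "t \<in> carrier D" and consistent: "t \<sqinter> \<sim> t = \<zero>"
  shows "\<sim> (x \<sqinter> t) \<sqinter> t = \<sim> x \<sqinter> t"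
proof -
  have "\<sim> (x \<sqinter> t) \<sqinter> t = (\<sim> x \<sqinter> t) \<squnion> (\<sim> t \<sqinter> t)"
    by (simp add: assms neg_meet closed join_meet_distrib_right)
  also have "\<sim> t \<sqinter> t = \<zero>"
    using assms by (simp add: meet_commute neg_closed)
  finally show ?thesis
    by (simp add: assms closed join_zero)
qed

end

text \<open>The common form of \<open>Dia D\<close> (at \<open>t = \<top>\<close>) and \<open>Box D\<close> (at \<open>t = \<bottom>\<close>). The negation is given
  on representatives, so that it matches theirs literally.\<close>

definition relativized :: "('a, 'm) dm_algebra_scheme \<Rightarrow> 'a \<Rightarrow> 'a dm_algebra" where
  "relativized D t = \<lparr> carrier = (\<lambda>a. a \<sqinter>\<^bsub>D\<^esub> t) ` carrier D,
     meet = meet D,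
     join = join D,
     neg = (\<lambda>y. THE z. \<exists>a\<in>carrier D. y = a \<sqinter>\<^bsub>D\<^esub> t \<and> z = \<sim>\<^bsub>D\<^esub> a \<sqinter>\<^bsub>D\<^esub> t),
     zero = \<zero>\<^bsub>D\<^esub>,
     one = t \<rparr>"

lemma Dia_eq_relativized: "Dia D = relativized D \<top>\<^bsub>D\<^esub>"
  by (simp add: Dia_def relativized_def dia_def[abs_def])

lemma Box_eq_relativized: "Box D = relativized D \<bottom>\<^bsub>D\<^esub>"
  by (simp add: Box_def relativized_def box_def[abs_def])

lemma relativized_simps [simp]:
  "carrier (relativized D t) = (\<lambda>a. a \<sqinter>\<^bsub>D\<^esub> t) ` carrier D"
  "meet (relativized D t) = meet D"
  "join (relativized D t) = join D"
  "zero (relativized D t) = \<zero>\<^bsub>D\<^esub>"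
  "one (relativized D t) = t"
  by (simp_all add: relativized_def)

context de_morgan_algebra
begin

lemma relativized_neg:
  assumes a: "a \<in> carrier D" and t: "t \<in> carrier D" and consistent: "t \<sqinter> \<sim> t = \<zero>"
  shows "\<sim>\<^bsub>relativized D t\<^esub> (a \<sqinter> t) = \<sim> a \<sqinter> t"
proof -
  have "(THE z. \<exists>b\<in>carrier D. a \<sqinter> t = b \<sqinter> t \<and> z = \<sim> b \<sqinter> t) = \<sim> a \<sqinter> t"
  proof (rule the_equality)
    show "\<exists>b\<in>carrier D. a \<sqinter> t = b \<sqinter> t \<and> \<sim> a \<sqinter> t = \<sim> b \<sqinter> t"
      using a by blast
  next
    fix z
    assume "\<exists>b\<in>carrier D. a \<sqinter> t = b \<sqinter> t \<and> z = \<sim> b \<sqinter> t"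
    then show "z = \<sim> a \<sqinter> t"
      using neg_meet_meet_consistent[OF _ t consistent] a by metis
  qed
  then show ?thesis
    by (simp add: relativized_def)
qed

lemma relativized_de_morgan_algebra:
  assumes t: "t \<in> carrier D" and consistent: "t \<sqinter> \<sim> t = \<zero>"
  shows "de_morgan_algebra (relativized D t)"
proof -
  let ?R = "relativized D t"
  note neg_R = relativized_neg[OF _ t consistent]
  have in_D: "x \<in> carrier D" if "x \<in> carrier ?R" for x
    using that t by (auto simp: meet_closed)
  have below: "x \<sqinter> t = x" if "x \<in> carrier ?R" for x
    using that t by (auto simp: meet_right_idem)
  have in_R: "x \<in> carrier ?R" if "x \<in> carrier D" "x \<sqinter> t = x" for x
    using that by (auto intro: rev_image_eqI)
  have neg_R': "\<sim>\<^bsub>?R\<^esub> x = \<sim> x \<sqinter> t" if "x \<in> carrier ?R" for x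
    using neg_R[OF in_D[OF that]] below[OF that] by simp
  have meet_R: "x \<sqinter> y \<in> carrier ?R" if "x \<in> carrier ?R" "y \<in> carrier ?R" for x y
    by (rule in_R) (simp_all add: in_D[OF that(1)] in_D[OF that(2)] t meet_closed
        meet_meet_distrib_right below[OF that(1)] below[OF that(2)])
  \<comment> \<open>Goals 1 to 5 are closure, 14 is the unit law, 15 and 16 are the laws of negation;
    the remaining lattice identities are inherited from \<open>D\<close>.\<close>
  show ?thesis
  proof (unfold_locales, goal_cases)
    case (1 x y)
    then show ?case using meet_R by simp
  next
    case (2 x y)
    then have "x \<squnion> y \<in> carrier ?R"
      by (intro in_R) (simp_all add: in_D t join_closed join_meet_distrib_right below
          del: relativized_simps(1))
    then show ?case by simp
  next
    case (3 x)
    then have "\<sim> x \<in> carrier D" using in_D neg_closed by blast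
    then show ?case using 3 by (simp only: neg_R') simp
  next
    case 4
    then show ?case
      by (rule in_R) (simp_all add: zero_closed zero_meet t)
  next
    case 5
    then show ?case
      by (rule in_R) (simp_all add: meet_idem t)
  next
    case (14 x)
    then show ?case using below[OF 14] t in_D[OF 14] by (simp add: meet_commute)
  next
    case (15 x)
    note x = in_D[OF 15]
    have "\<sim>\<^bsub>?R\<^esub> (\<sim>\<^bsub>?R\<^esub> x) = \<sim> (\<sim> x) \<sqinter> t"
      by (simp only: neg_R'[OF 15] neg_R[OF neg_closed[OF x]])
    then show ?case by (simp only: neg_neg[OF x] below[OF 15])
  next
    case (16 x y)
    then have "\<sim>\<^bsub>?R\<^esub> (x \<sqinter> y) = \<sim> (x \<sqinter> y) \<sqinter> t"
      by (simp only: neg_R' meet_R)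
    with 16 show ?case
      by (simp add: in_D neg_R' neg_meet neg_closed t join_meet_distrib_right
          del: relativized_simps(1))
  qed (auto dest!: in_D simp: meet_assoc join_assoc meet_join_absorb join_meet_absorb
      meet_join_distrib zero_join simp del: relativized_simps(1) intro: meet_commute join_commute)
qed

end

context rff_algebra
begin

lemma rbot_closed: "\<bottom> \<in> carrier D"
  by (simp add: rbot_def neg_closed top_closed)

lemma top_consistent: "\<top> \<sqinter> \<sim> \<top> = \<zero>"
  by (rule RFf2)

lemma rbot_consistent: "\<bottom> \<sqinter> \<sim> \<bottom> = \<zero>"
  using RFf2 by (simp add: rbot_def neg_neg neg_closed meet_commute top_closed)

lemma Dia_neg: "a \<in> carrier D \<Longrightarrow> \<sim>\<^bsub>Dia D\<^esub> (dia D a) = dia D (\<sim> a)"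
  unfolding Dia_eq_relativized dia_def by (rule relativized_neg[OF _ top_closed top_consistent])

lemma Box_neg: "a \<in> carrier D \<Longrightarrow> \<sim>\<^bsub>Box D\<^esub> (box D a) = box D (\<sim> a)"
  unfolding Box_eq_relativized box_def by (rule relativized_neg[OF _ rbot_closed rbot_consistent])

lemma Dia_de_morgan_algebra: "de_morgan_algebra (Dia D)"
  unfolding Dia_eq_relativized by (rule relativized_de_morgan_algebra[OF top_closed top_consistent])

lemma Box_de_morgan_algebra: "de_morgan_algebra (Box D)"
  unfolding Box_eq_relativized by (rule relativized_de_morgan_algebra[OF rbot_closed rbot_consistent])

definition twist_map :: "'a \<Rightarrow> 'a \<times> 'a" where
  "twist_map a = (dia D a, box D (\<sim> a))"

text \<open>Negating \<open>\<sim> a \<sqinter> \<bottom>\<close> gives \<open>a \<squnion> \<top>\<close>, so equal images provide both hypotheses of RFf3.\<close>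

lemma inj_on_twist_map: "inj_on twist_map (carrier D)"
proof (rule inj_onI)
  fix a b
  assume ab: "a \<in> carrier D" "b \<in> carrier D" and eq: "twist_map a = twist_map b"
  have negated: "\<sim> (\<sim> c \<sqinter> \<bottom>) = c \<squnion> \<top>" if "c \<in> carrier D" for c
    using that by (simp add: rbot_def neg_meet neg_neg neg_closed top_closed)
  have "a \<sqinter> \<top> = b \<sqinter> \<top>" and "\<sim> a \<sqinter> \<bottom> = \<sim> b \<sqinter> \<bottom>"
    using eq by (simp_all add: twist_map_def dia_def box_def)
  then show "a = b"
    using RFf3[OF ab] negated ab by metis
qed

lemma twist_map_closed: "a \<in> carrier D \<Longrightarrow> twist_map a \<in> carrier (Dia D \<bowtie> Box D)"
  by (simp add: twist_map_def twist_def Dia_def Box_def neg_closed)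

lemma twist_map_neg:
  "a \<in> carrier D \<Longrightarrow> twist_map (\<sim> a) = \<sim>\<^bsub>Dia D \<bowtie> Box D\<^esub> (twist_map a)"
  by (simp add: twist_map_def twist_def twist_neg_def Dia_neg Box_neg neg_closed)

lemma twist_map_meet:
  assumes "a \<in> carrier D" "b \<in> carrier D"
  shows "twist_map (a \<sqinter> b) = twist_map a \<sqinter>\<^bsub>Dia D \<bowtie> Box D\<^esub> twist_map b"
  using assms
  by (simp add: twist_map_def twist_def twist_meet_def Dia_def Box_def dia_def box_def neg_meet
      neg_closed top_closed rbot_closed meet_meet_distrib_right join_meet_distrib_right)

text \<open>Joins in both algebras are the De Morgan duals of meets.\<close>

lemma twist_map_join:
  assumes "a \<in> carrier D" "b \<in> carrier D"
  shows "twist_map (a \<squnion> b) = twist_map a \<squnion>\<^bsub>Dia D \<bowtie> Box D\<^esub> twist_map b"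
proof -
  let ?T = "Dia D \<bowtie> Box D"
  have "a \<squnion> b = \<sim> (\<sim> a \<sqinter> \<sim> b)"
    using assms by (simp add: neg_meet neg_neg neg_closed)
  then have "twist_map (a \<squnion> b) = \<sim>\<^bsub>?T\<^esub> (\<sim>\<^bsub>?T\<^esub> (twist_map a) \<sqinter>\<^bsub>?T\<^esub> \<sim>\<^bsub>?T\<^esub> (twist_map b))"
    using assms by (simp add: twist_map_neg twist_map_meet closed)
  then show ?thesis
    by (simp add: twist_def)
qed

lemma twist_map_zero: "twist_map \<zero> = \<zero>\<^bsub>Dia D \<bowtie> Box D\<^esub>"
  by (simp add: twist_map_def twist_def Dia_def Box_def dia_def box_def zero_meet neg_zero one_meet
      top_closed rbot_closed)

lemma twist_map_one: "twist_map \<one> = \<one>\<^bsub>Dia D \<bowtie> Box D\<^esub>"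
  by (simp add: twist_map_def twist_def Dia_def Box_def dia_def box_def zero_meet neg_one one_meet
      top_closed rbot_closed)

text \<open>It suffices to treat \<open>\<bottom>\<close>, of which \<open>\<top>\<close> is the negation on both sides; \<open>\<bottom>\<close> goes to
  \<open>(\<zero>, \<zero>)\<close> by RFf2.\<close>

lemma twist_map_top: "twist_map \<top> = \<top>\<^bsub>Dia D \<bowtie> Box D\<^esub>"
proof -
  have "twist_map \<bottom> = (\<zero>, \<zero>)"
    using RFf2 by (simp add: twist_map_def dia_def box_def rbot_def neg_neg neg_closed
        meet_commute top_closed)
  moreover have "\<top> = \<sim> \<bottom>"
    by (simp add: rbot_def neg_neg top_closed)
  ultimately show ?thesis
    using twist_map_neg[OF rbot_closed] by (simp add: twist_def Dia_def Box_def)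
qed

end

theorem theorem63:
  fixes D :: "'a rff_algebra"
  assumes "rff_algebra D"
  shows "\<exists>C. rff_twist_algebra (Dia D) (Box D) C \<and>
             rff_isomorphism (\<lambda>a. (dia D a, box D (\<sim>\<^bsub>D\<^esub> a))) D C"
proof -
  interpret rff_algebra D by (rule assms)
  let ?T = "Dia D \<bowtie> Box D"
  let ?C = "?T \<lparr> carrier := twist_map ` carrier D \<rparr>"
  note hom = twist_map_meet twist_map_join twist_map_neg twist_map_zero twist_map_one twist_map_top
  have "rff_subalgebra ?C ?T"
    unfolding rff_subalgebra_def
    by (auto simp: hom[symmetric] twist_map_closed closed top_closed)
  moreover have "fst ` twist_map ` carrier D = carrier (Dia D)"
    by (simp add: image_image twist_map_def Dia_def)
  ultimately have "rff_twist_algebra (Dia D) (Box D) ?C"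
    by (simp add: rff_twist_algebra_def Dia_de_morgan_algebra Box_de_morgan_algebra)
  moreover have "rff_isomorphism twist_map D ?C"
    by (simp add: rff_isomorphism_def bij_betw_def inj_on_twist_map hom)
  ultimately show ?thesis
    unfolding twist_map_def by blast
qed

end
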